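(* Let $\Gamma$ be a sequent and $\mathcal{T}$ be a TBox with associated concept assertion $T \geq 1$. If there exists an open tableau $G$ for $\Gamma$ and $T \geq 1$, then $\Gamma$ is $\mathcal T$-satisfiable.
   Context: Non-expansive fuzzy $\mathcal{ALC}$: over atomic concepts $\mathsf{N_C}$ and role names $\mathsf{N_R}$, concepts are $C,D ::= p \mid c \mid \lnot C \mid C \ominus c \mid C \sqcap D \mid \exists R.C$ ($c$ a rational constant in $[0,1]$). An interpretation $\mathcal{I}$ has nonempty domain $\Delta^\mathcal{I}$, $p^\mathcal{I}:\Delta^\mathcal{I}\to[0,1]$, $R^\mathcal{I}:\Delta^\mathcal{I}\times\Delta^\mathcal{I}\to[0,1]$, with $c^\mathcal{I}(x)=c$, $(\lnot D)^\mathcal{I}(x)=1-D^\mathcal{I}(x)$, $(C\ominus c)^\mathcal{I}(x)=\max(C^\mathcal{I}(x)-c,0)$, $(C\sqcap D)^\mathcal{I}(x)=\min$, $(\exists R.C)^\mathcal{I}(x)=\sup_y\min(R^\mathcal{I}(x,y),C^\mathcal{I}(y))$; $C\sqcup D=\lnot(\lnot C\sqcap\lnot D)$, $C\oplus c=\lnot((\lnot C)\ominus c)$. Concept assertions $C\bowtie c$, ${\bowtie}\in\{<,\le,>,\ge\}$; a sequent is a finite set of them. A TBox is a set of GCIs $C\sqsubseteq D$, satisfied by $\mathcal{I}$ if $C^\mathcal{I}(x)\le D^\mathcal{I}(x)$ for all $x$; $\Gamma$ is $\mathcal{T}$-satisfiable if some $\mathcal{I}$ satisfying $\mathcal{T}$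 has an individual satisfying all assertions of $\Gamma$. Associated concept assertion of $\mathcal{T}=\{C_i\sqsubseteq D_i\}_{i=1}^n$ and $\Gamma$: $Z=[0,1]\cap$ (additive subgroup of $\mathbb{Q}$ generated by $1$ and the constants in $\Gamma,\mathcal{T}$), $\epsilon=\frac12\min(Z\setminus\{0\})$, $Z'=Z\cup\{z+\epsilon\mid z\in Z\setminus\{1\}\}$, and $T=T_1\sqcap\cdots\sqcap T_n$ with $T_i=\bigsqcup_{z\in Z'}((\lnot C_i\oplus z)\sqcap(D_i\oplus(1-z)))$. Tableau rules (with ${\triangleleft}\in\{<,\le\}$, ${\triangleright}\in\{>,\ge\}$; ${\bowtie^\circ}$ reverses direction: $>\leftrightarrow<$, $\ge\leftrightarrow\le$; for a pair $(\triangleleft,\triangleright)$ let $\blacktriangleleft$ be $<$ if $(\triangleleft,\triangleright)=(\le,\ge)$ and $\le$ otherwise): (Ax 1) $S,p\triangleright c\,/\,\bot$ if no value in $[0,1]$ satisfies $p\triangleright c$ (i.e. $c\ge1$ for $>$, $c>1$ for $\ge$), $p\in\mathsf{N_C}$; (Ax 0) $S,p\triangleleft c\,/\,\bot$ if $c\le 0$ for $<$, $c<0$ for $\le$; (Ax c) $S,c\triangleleft d\,/\,\bot$ for constants $c,d$ if $c\triangleleft d$ is false; (Ax p) $S,p\triangleleft c,p\triangleright d\,/\,\bot$ if $d\blacktriangleleft c$; ($\sqcap\triangleright$) $S,C\sqcap D\triangleright c\,/\,S,C\triangleright c,D\triangleright c$; ($\sqcap\triangleleft$) $S,C\sqcap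 D\triangleleft c\,/\,S,C\triangleleft c \mid S,D\triangleleft c$ (two conclusions); ($\lnot\bowtie$) $S,\lnot C\bowtie c\,/\,S,C\bowtie^\circ 1-c$; ($\ominus\triangleleft$) $S,C\ominus c\triangleleft d\,/\,S,C\triangleleft d+c,\ d\triangleleft^\circ 0$; ($\ominus\triangleright$) $S,C\ominus c\triangleright d\,/\,S,C\triangleright d+c$ provided $d\ge0$ for $>$ and $d>0$ for $\ge$; ($\exists R$) $S,\{\exists R.D_j\triangleleft_j d_j\mid 1\le j\le n\},\exists R.C\triangleright c\,/\,\{D_j\triangleleft_j d_j\mid d_j\blacktriangleleft_{(\triangleleft_j,\triangleright)}c\},C\triangleright c,T\ge1$, provided $c\ge0$ for $>$ resp. $c>0$ for $\ge$, and $S$ contains no assertion $\exists R.D\triangleleft d$. All rules except ($\exists R$) are propositional; a sequent is saturated if no propositional rule applies. A tableau graph has a directed graph $(V^G,E^G)$, a root $r^G$, and labels $\mathcal{L}^G(v)$ (a set of assertions or $\bot$); a node is an AND-node if its label is saturated, otherwise an OR-node. $G$ is a tableau for $\Gamma$ and $T\ge1$ if the root label is $\Gamma\cup\{T\ge1\}$, at each OR-node the children's labels are exactly the conclusions of one propositional rule instance applied to its label, and at each AND-node the children's labels are exactly the conclusions of all possible ($\exists R$) applications. A marking is a full subgraph containing the root, containing all children of its AND-nodes and at least one child of each of its OR-nodes; it is consistent if it has no node labelled $\bot$; $G$ is open if a consistent marking exists.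
   Formalization: As listed, the rules make the claim false (e.g. {p ≤ 1/5, p ≥ 4/5}, {p⊖1/2 < 0}, {∃R.p < 0} stay open); here (Ax p) closes when c ◀ d, (Ax c) covers all four comparisons, (Ax 0) also covers ∃R.C ◁ c, and a rule's principal assertion is consumed. *)

theory Defs
  imports Complex_Main "HOL-Computational_Algebra.Group_Closure"
begin

datatype ('p, 'r) concept =
    Atom 'p
  | Const rat
  | Neg "('p, 'r) concept"
  | Ominus "('p, 'r) concept" rat
  | Conj "('p, 'r) concept" "('p, 'r) concept"
  | ExR 'r "('p, 'r) concept"

abbreviation Disj :: "('p, 'r) concept \<Rightarrow> ('p, 'r) concept \<Rightarrow> ('p, 'r) concept" where
  "Disj C D \<equiv> Neg (Conj (Neg C) (Neg D))"

abbreviation Oplus :: "('p, 'r) concept \<Rightarrow> rat \<Rightarrow> ('p, 'r) concept" where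
  "Oplus C c \<equiv> Neg (Ominus (Neg C) c)"

primrec concept_consts :: "('p, 'r) concept \<Rightarrow> rat set" where
  "concept_consts (Atom p) = {}"
| "concept_consts (Const c) = {c}"
| "concept_consts (Neg C) = concept_consts C"
| "concept_consts (Ominus C c) = insert c (concept_consts C)"
| "concept_consts (Conj C D) = concept_consts C \<union> concept_consts D"
| "concept_consts (ExR R C) = concept_consts C"

(* The grammar only admits constants from the unit interval. This is a predicate instead of
   being built into the type because the rule for C \<ominus> c \<triangleleft> d produces an assertion
   whose concept is the constant d, and d may have left the unit interval. *)
definition wf_concept :: "('p, 'r) concept \<Rightarrow> bool" where
  "wf_concept C \<longleftrightarrow> concept_consts C \<subseteq> {0..1}"

record ('i, 'p, 'r) interp =
  indivs :: "'i set"
  atom_val :: "'p \<Rightarrow> 'i \<Rightarrow> real"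
  role_val :: "'r \<Rightarrow> 'i \<Rightarrow> 'i \<Rightarrow> real"

definition interpretation_ok :: "('i, 'p, 'r) interp \<Rightarrow> bool" where
  "interpretation_ok I \<longleftrightarrow>
     indivs I \<noteq> {} \<and>
     (\<forall>p. \<forall>x \<in> indivs I. atom_val I p x \<in> {0..1}) \<and>
     (\<forall>R. \<forall>x \<in> indivs I. \<forall>y \<in> indivs I. role_val I R x y \<in> {0..1})"

primrec ceval :: "('i, 'p, 'r) interp \<Rightarrow> ('p, 'r) concept \<Rightarrow> 'i \<Rightarrow> real" where
  "ceval I (Atom p) x = atom_val I p x"
| "ceval I (Const c) x = of_rat c"
| "ceval I (Neg C) x = 1 - ceval I C x"
| "ceval I (Ominus C c) x = max (ceval I C x - of_rat c) 0"
| "ceval I (Conj C D) x = min (ceval I C x) (ceval I D x)"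
| "ceval I (ExR R C) x = (SUP y \<in> indivs I. min (role_val I R x y) (ceval I C y))"

datatype cmp = Lt | Le | Gt | Ge

primrec holds :: "cmp \<Rightarrow> 'a::ord \<Rightarrow> 'a \<Rightarrow> bool" where
  "holds Lt a b \<longleftrightarrow> a < b"
| "holds Le a b \<longleftrightarrow> a \<le> b"
| "holds Gt a b \<longleftrightarrow> a > b"
| "holds Ge a b \<longleftrightarrow> a \<ge> b"

abbreviation uppers :: "cmp set" where "uppers \<equiv> {Lt, Le}"
abbreviation lowers :: "cmp set" where "lowers \<equiv> {Gt, Ge}"

primrec rev_cmp :: "cmp \<Rightarrow> cmp" where
  "rev_cmp Lt = Gt"
| "rev_cmp Le = Ge"
| "rev_cmp Gt = Lt"
| "rev_cmp Ge = Le"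

(* clash u l a b is a \<blacktriangleleft> b for the pair (u, l): the bounds "u a" from above and
   "l b" from below exclude each other. *)
definition clash :: "cmp \<Rightarrow> cmp \<Rightarrow> rat \<Rightarrow> rat \<Rightarrow> bool" where
  "clash u l a b \<longleftrightarrow> (if (u, l) = (Le, Ge) then a < b else a \<le> b)"

definition nontrivial_lower :: "cmp \<Rightarrow> rat \<Rightarrow> bool" where
  "nontrivial_lower l c \<longleftrightarrow> (l = Gt \<and> c \<ge> 0) \<or> (l = Ge \<and> c > 0)"

(* The bound of an assertion ranges over all rationals: the rules leave the unit interval. *)
type_synonym ('p, 'r) assertion = "('p, 'r) concept \<times> cmp \<times> rat"

definition sequent :: "('p, 'r) assertion set \<Rightarrow> bool" where
  "sequent \<Gamma> \<longleftrightarrow> finite \<Gamma> \<and> (\<forall>(C, b, c) \<in> \<Gamma>. wf_concept C)"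

fun sat_assertion :: "('i, 'p, 'r) interp \<Rightarrow> 'i \<Rightarrow> ('p, 'r) assertion \<Rightarrow> bool" where
  "sat_assertion I x (C, b, c) \<longleftrightarrow> holds b (ceval I C x) (of_rat c)"

(* The pair (C, D) stands for the inclusion C \<sqsubseteq> D. *)
type_synonym ('p, 'r) gci = "('p, 'r) concept \<times> ('p, 'r) concept"

definition tbox :: "('p, 'r) gci set \<Rightarrow> bool" where
  "tbox TB \<longleftrightarrow> finite TB \<and> (\<forall>(C, D) \<in> TB. wf_concept C \<and> wf_concept D)"

definition sat_tbox :: "('i, 'p, 'r) interp \<Rightarrow> ('p, 'r) gci set \<Rightarrow> bool" where
  "sat_tbox I TB \<longleftrightarrow> (\<forall>(C, D) \<in> TB. \<forall>x \<in> indivs I. ceval I C x \<le> ceval I D x)"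

(* HOL cannot quantify over the type of individuals inside a formula, so it is a parameter;
   domains are arbitrary nonempty subsets of it. *)
definition satisfiable :: "'i itself \<Rightarrow> ('p, 'r) gci set \<Rightarrow> ('p, 'r) assertion set \<Rightarrow> bool" where
  "satisfiable _ TB \<Gamma> \<longleftrightarrow>
     (\<exists>I :: ('i, 'p, 'r) interp. interpretation_ok I \<and> sat_tbox I TB \<and>
        (\<exists>x \<in> indivs I. \<forall>A \<in> \<Gamma>. sat_assertion I x A))"

definition all_consts :: "('p, 'r) gci set \<Rightarrow> ('p, 'r) assertion set \<Rightarrow> rat set" where
  "all_consts TB \<Gamma> =
     (\<Union>(C, b, c) \<in> \<Gamma>. insert c (concept_consts C)) \<union>
     (\<Union>(C, D) \<in> TB. concept_consts C \<union> concept_consts D)"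

definition Zset :: "('p, 'r) gci set \<Rightarrow> ('p, 'r) assertion set \<Rightarrow> rat set" where
  "Zset TB \<Gamma> = {0..1} \<inter> group_closure (insert 1 (all_consts TB \<Gamma>))"

definition Zeps :: "('p, 'r) gci set \<Rightarrow> ('p, 'r) assertion set \<Rightarrow> rat" where
  "Zeps TB \<Gamma> = Min (Zset TB \<Gamma> - {0}) / 2"

definition Zset' :: "('p, 'r) gci set \<Rightarrow> ('p, 'r) assertion set \<Rightarrow> rat set" where
  "Zset' TB \<Gamma> = Zset TB \<Gamma> \<union> (\<lambda>z. z + Zeps TB \<Gamma>) ` (Zset TB \<Gamma> - {1})"

(* Empty conjunctions (for the empty TBox) and disjunctions are the constants 1 and 0. *)
fun big_conj :: "('p, 'r) concept list \<Rightarrow> ('p, 'r) concept" where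
  "big_conj [] = Const 1"
| "big_conj [C] = C"
| "big_conj (C # D # Cs) = Conj C (big_conj (D # Cs))"

fun big_disj :: "('p, 'r) concept list \<Rightarrow> ('p, 'r) concept" where
  "big_disj [] = Const 0"
| "big_disj [C] = C"
| "big_disj (C # D # Cs) = Disj C (big_disj (D # Cs))"

definition gci_concept :: "rat list \<Rightarrow> ('p, 'r) gci \<Rightarrow> ('p, 'r) concept" where
  "gci_concept zs g =
     big_disj (map (\<lambda>z. Conj (Oplus (Neg (fst g)) z) (Oplus (snd g) (1 - z))) zs)"

(* T is determined only up to the order in which the TBox and Z' are listed. *)
definition assoc_concept ::
    "('p, 'r) gci set \<Rightarrow> ('p, 'r) assertion set \<Rightarrow> ('p, 'r) concept \<Rightarrow> bool" where
  "assoc_concept TB \<Gamma> T \<longleftrightarrow>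
     (\<exists>gs zs. distinct gs \<and> set gs = TB \<and> distinct zs \<and> set zs = Zset' TB \<Gamma> \<and>
        T = big_conj (map (gci_concept zs) gs))"

lemma finite_concept_consts: "finite (concept_consts C)"
  by (induction C) auto

lemma common_denominator:
  assumes "finite (S :: rat set)"
  shows "\<exists>N > 0. \<forall>s \<in> S. \<exists>k :: int. s = of_int k / of_int N"
  using assms
proof (induction S rule: finite_induct)
  case empty
  show ?case by (auto intro: exI[of _ 1])
next
  case (insert x S)
  then obtain N :: int where N: "N > 0" "\<forall>s \<in> S. \<exists>k :: int. s = of_int k / of_int N"
    by auto
  obtain a b :: int where ab: "b > 0" "x = of_int a / of_int b"
    by (metis quotient_of_denom_pos' quotient_of_div surjective_pairing)
  have "\<exists>k :: int. s = of_int k / of_int (N * b)" if s: "s \<in> insert x S" for s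
  proof (cases "s = x")
    case True
    then have "s = of_int (a * N) / of_int (N * b)" using ab N by simp
    then show ?thesis by blast
  next
    case False
    then obtain k where "s = of_int k / of_int N" using N s by auto
    then have "s = of_int (k * b) / of_int (N * b)" using ab by simp
    then show ?thesis by blast
  qed
  moreover have "N * b > 0" using N ab by simp
  ultimately show ?case by blast
qed

lemma finite_unit_group_closure:
  assumes "finite (S :: rat set)"
  shows "finite ({0..1} \<inter> group_closure S)"
proof -
  obtain N :: int where N: "N > 0" "\<forall>s \<in> S. \<exists>k :: int. s = of_int k / of_int N"
    using common_denominator[OF assms] by blast
  have closure: "\<exists>k :: int. x = of_int k / of_int N" if "x \<in> group_closure S" for x
    using that
  proof induction
    case (base s)
    then show ?case using N by (auto intro: exI[of _ 0])
  next
    case (diff s t)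
    then obtain j k where "s = of_int j / of_int N" "t = of_int k / of_int N" by blast
    then have "s - t = of_int (j - k) / of_int N" by (simp add: diff_divide_distrib)
    then show ?case by blast
  qed
  have "{0..1} \<inter> group_closure S \<subseteq> (\<lambda>k. of_int k / of_int N) ` {0..N}"
  proof
    fix x :: rat
    assume x: "x \<in> {0..1} \<inter> group_closure S"
    then obtain k where k: "x = of_int k / of_int N" using closure by blast
    with x N have "k \<in> {0..N}" by (auto simp: field_simps)
    with k show "x \<in> (\<lambda>k. of_int k / of_int N) ` {0..N}" by blast
  qed
  then show ?thesis using finite_subset by blast
qed

lemma finite_Zset:
  assumes "sequent \<Gamma>" and "tbox TB"
  shows "finite (Zset TB \<Gamma>)"
  unfolding Zset_def using assms
  by (intro finite_unit_group_closure)
     (auto simp: all_consts_def sequent_def tbox_def finite_concept_consts)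

lemma assoc_concept_exists:
  assumes "sequent \<Gamma>" and "tbox TB"
  shows "\<exists>T. assoc_concept TB \<Gamma> T"
proof -
  have "finite (Zset' TB \<Gamma>)" using finite_Zset[OF assms] by (simp add: Zset'_def)
  then obtain zs where "set zs = Zset' TB \<Gamma>" "distinct zs" using finite_distinct_list by blast
  moreover obtain gs where "set gs = TB" "distinct gs"
    using assms finite_distinct_list by (auto simp: tbox_def)
  ultimately show ?thesis
    unfolding assoc_concept_def by blast
qed

datatype ('p, 'r) label = Bot | Seq "('p, 'r) assertion set"

(* prop_rule P Q: a propositional rule instance with premise P and set of conclusions Q.
   In "S, A" the principal assertion A is not a member of S, so it is consumed by the rule;
   otherwise a tableau could loop on the same propositional rule forever.
   Ax_p closes exactly the contradictory pairs: upper bound c \<blacktriangleleft> lower bound d.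
   Ax_c is needed for all four comparisons (the rule for C \<ominus> c \<triangleleft> d creates lower
   bounds on constants), and since no propositional rule decomposes \<exists>R.C \<triangleleft> c, its
   unsatisfiable instances have to be closed like those of p \<triangleleft> c, by Ax_0_ex. *)
inductive prop_rule :: "('p, 'r) assertion set \<Rightarrow> ('p, 'r) label set \<Rightarrow> bool" where
  Ax_1: "(l = Gt \<and> c \<ge> 1) \<or> (l = Ge \<and> c > 1) \<Longrightarrow>
    prop_rule (insert (Atom p, l, c) S) {Bot}"
| Ax_0: "(u = Lt \<and> c \<le> 0) \<or> (u = Le \<and> c < 0) \<Longrightarrow>
    prop_rule (insert (Atom p, u, c) S) {Bot}"
| Ax_0_ex: "(u = Lt \<and> c \<le> 0) \<or> (u = Le \<and> c < 0) \<Longrightarrow>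
    prop_rule (insert (ExR R C, u, c) S) {Bot}"
| Ax_c: "\<not> holds b c d \<Longrightarrow>
    prop_rule (insert (Const c, b, d) S) {Bot}"
| Ax_p: "u \<in> uppers \<Longrightarrow> l \<in> lowers \<Longrightarrow> clash u l c d \<Longrightarrow>
    prop_rule (insert (Atom p, u, c) (insert (Atom p, l, d) S)) {Bot}"
| Conj_lower: "l \<in> lowers \<Longrightarrow> (Conj C D, l, c) \<notin> S \<Longrightarrow>
    prop_rule (insert (Conj C D, l, c) S) {Seq (S \<union> {(C, l, c), (D, l, c)})}"
| Conj_upper: "u \<in> uppers \<Longrightarrow> (Conj C D, u, c) \<notin> S \<Longrightarrow>
    prop_rule (insert (Conj C D, u, c) S) {Seq (S \<union> {(C, u, c)}), Seq (S \<union> {(D, u, c)})}"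
| Neg_cmp: "(Neg C, b, c) \<notin> S \<Longrightarrow>
    prop_rule (insert (Neg C, b, c) S) {Seq (S \<union> {(C, rev_cmp b, 1 - c)})}"
| Ominus_upper: "u \<in> uppers \<Longrightarrow> (Ominus C c, u, d) \<notin> S \<Longrightarrow>
    prop_rule (insert (Ominus C c, u, d) S)
      {Seq (S \<union> {(C, u, d + c), (Const d, rev_cmp u, 0)})}"
| Ominus_lower: "l \<in> lowers \<Longrightarrow> nontrivial_lower l d \<Longrightarrow> (Ominus C c, l, d) \<notin> S \<Longrightarrow>
    prop_rule (insert (Ominus C c, l, d) S) {Seq (S \<union> {(C, l, d + c)})}"

(* The side condition that S contains no \<exists>R.D \<triangleleft> d forces the displayed family to
   consist of all assertions of this form in the premise. *)
inductive ex_rule ::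
    "('p, 'r) concept \<Rightarrow> ('p, 'r) assertion set \<Rightarrow> ('p, 'r) assertion set \<Rightarrow> bool" for T where
  "(ExR R C, l, c) \<in> P \<Longrightarrow> l \<in> lowers \<Longrightarrow> nontrivial_lower l c \<Longrightarrow>
    ex_rule T P ({(D, u, d) | D u d. (ExR R D, u, d) \<in> P \<and> u \<in> uppers \<and> clash u l d c}
                 \<union> {(C, l, c), (T, Ge, 1)})"

(* No rule applies to Bot, hence it is saturated. *)
definition saturated :: "('p, 'r) label \<Rightarrow> bool" where
  "saturated L \<longleftrightarrow> \<not> (\<exists>P Q. L = Seq P \<and> prop_rule P Q)"

record ('v, 'p, 'r) tableau_graph =
  verts :: "'v set"
  edges :: "('v \<times> 'v) set"
  root_node :: 'v
  lab :: "'v \<Rightarrow> ('p, 'r) label"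

definition children :: "('v, 'p, 'r) tableau_graph \<Rightarrow> 'v \<Rightarrow> 'v set" where
  "children G v = {w. (v, w) \<in> edges G}"

definition and_node :: "('v, 'p, 'r) tableau_graph \<Rightarrow> 'v \<Rightarrow> bool" where
  "and_node G v \<longleftrightarrow> saturated (lab G v)"

abbreviation or_node :: "('v, 'p, 'r) tableau_graph \<Rightarrow> 'v \<Rightarrow> bool" where
  "or_node G v \<equiv> \<not> and_node G v"

definition tableau ::
    "('v, 'p, 'r) tableau_graph \<Rightarrow> ('p, 'r) assertion set \<Rightarrow> ('p, 'r) concept \<Rightarrow> bool" where
  "tableau G \<Gamma> T \<longleftrightarrow>
     root_node G \<in> verts G \<and> edges G \<subseteq> verts G \<times> verts G \<and>
     lab G (root_node G) = Seq (\<Gamma> \<union> {(T, Ge, 1)}) \<and>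
     (\<forall>v \<in> verts G. or_node G v \<longrightarrow>
        (\<exists>P Q. lab G v = Seq P \<and> prop_rule P Q \<and> lab G ` children G v = Q)) \<and>
     (\<forall>v \<in> verts G. and_node G v \<longrightarrow>
        lab G ` children G v = {Seq Q | P Q. lab G v = Seq P \<and> ex_rule T P Q})"

(* A full subgraph is given by its set of vertices. *)
definition marking :: "('v, 'p, 'r) tableau_graph \<Rightarrow> 'v set \<Rightarrow> bool" where
  "marking G M \<longleftrightarrow>
     M \<subseteq> verts G \<and> root_node G \<in> M \<and>
     (\<forall>v \<in> M. and_node G v \<longrightarrow> children G v \<subseteq> M) \<and>
     (\<forall>v \<in> M. or_node G v \<longrightarrow> children G v \<inter> M \<noteq> {})"

definition consistent_marking :: "('v, 'p, 'r) tableau_graph \<Rightarrow> 'v set \<Rightarrow> bool" where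
  "consistent_marking G M \<longleftrightarrow> marking G M \<and> (\<forall>v \<in> M. lab G v \<noteq> Bot)"

definition open_tableau :: "('v, 'p, 'r) tableau_graph \<Rightarrow> bool" where
  "open_tableau G \<longleftrightarrow> (\<exists>M. consistent_marking G M)"

end

theory Submission
  imports Defs "HOL-Library.Countable_Set"
begin

text \<open>
  A propositional rule replaces an assertion by assertions on smaller concepts, so from every
  node of a consistent marking a path of chosen children ends at a saturated label, and the
  union of the labels on that path is a finite Hintikka set. Each application of the existential
  rule to such a set is realised by another one, and closing off from the root gives countably
  many, which become the individuals. Since clash describes exactly the contradictory pairs of
  bounds and the sets are finite, atoms and role edges can be given values in the unit interval
  that meet all their bounds. For the role edge of an assertion $\exists R.C \triangleright c$
  these are $\triangleright c$ and the bounds $\triangleleft d$ of all those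
  $\exists R.D \triangleleft d$ whose $D \triangleleft d$ the existential rule does not hand
  on to the successor. Finally, $T \geq 1$ holds at every individual, and $T_i \geq 1$ yields
  some $z$ with $C_i \leq z \leq D_i$.
\<close>

section \<open>Comparisons\<close>

lemma upper_lower_cases:
  obtains (upper) "b \<in> uppers" | (lower) "b \<in> lowers"
  by (cases b) auto

lemma holds_rev_cmp [simp]: "holds (rev_cmp b) v w \<longleftrightarrow> holds b w v"
  by (cases b) auto

lemma holds_of_rat [simp]:
  "holds b (of_rat c :: 'a :: linordered_field) (of_rat d) \<longleftrightarrow> holds b c d"
  "holds b (0 :: 'a) (of_rat d) \<longleftrightarrow> holds b 0 d"
  "holds b (1 :: 'a) (of_rat d) \<longleftrightarrow> holds b 1 d"
  by (cases b; simp add: of_rat_less of_rat_less_eq)+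

lemma holds_diff_left:
  fixes v w d :: "'a :: linordered_ab_group_add"
  shows "holds b (v - d) w \<longleftrightarrow> holds b v (w + d)"
  by (cases b) (auto simp: algebra_simps)

lemma holds_one_minus_left:
  fixes v w :: "'a :: linordered_idom"
  shows "holds b (1 - v) w \<longleftrightarrow> holds b (1 - w) v"
  by (cases b) (auto simp: algebra_simps)

lemma holds_lower_mono:
  fixes v w d :: "'a :: order"
  assumes "l \<in> lowers" "holds l v d" "v \<le> w"
  shows "holds l w d"
  using assms by auto

lemma holds_upper_min:
  fixes v w d :: "'a :: linorder"
  assumes "u \<in> uppers"
  shows "holds u (min v w) d \<longleftrightarrow> holds u v d \<or> holds u w d"
  using assms by (auto simp: min_less_iff_disj min_le_iff_disj)

lemma holds_lower_min:
  fixes v w d :: "'a :: linorder"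
  assumes "l \<in> lowers"
  shows "holds l (min v w) d \<longleftrightarrow> holds l v d \<and> holds l w d"
  using assms by auto

lemma holds_upper_max:
  fixes v w d :: "'a :: linorder"
  assumes "u \<in> uppers"
  shows "holds u (max v w) d \<longleftrightarrow> holds u v d \<and> holds u w d"
  using assms by auto

lemma holds_lower_max:
  fixes v w d :: "'a :: linorder"
  assumes "l \<in> lowers"
  shows "holds l (max v w) d \<longleftrightarrow> holds l v d \<or> holds l w d"
  using assms by (auto simp: less_max_iff_disj le_max_iff_disj)

lemma holds_finite_SUP:
  fixes f :: "'a \<Rightarrow> 'b :: conditionally_complete_linorder"
  assumes "finite (f ` X)" "X \<noteq> {}" "\<And>x. x \<in> X \<Longrightarrow> holds b (f x) d"
  shows "holds b (SUP x \<in> X. f x) d"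
proof -
  have "(SUP x \<in> X. f x) \<in> f ` X"
    using assms(1,2) Max_in[of "f ` X"] by (simp add: cSup_eq_Max)
  then show ?thesis using assms(3) by auto
qed

lemma nontrivial_lower_iff: "nontrivial_lower l c \<longleftrightarrow> l \<in> lowers \<and> \<not> holds l 0 c"
  by (cases l) (auto simp: nontrivial_lower_def)

lemma not_clash_iff:
  assumes "u \<in> uppers" "l \<in> lowers"
  shows "\<not> clash u l c d \<longleftrightarrow> d < c \<or> d = c \<and> u = Le \<and> l = Ge"
  using assms by (auto simp: clash_def)


section \<open>Bounds\<close>

definition consistent_bounds :: "(cmp \<times> rat) set \<Rightarrow> bool" where
  "consistent_bounds B \<longleftrightarrow>
     (\<forall>(u, c) \<in> B. \<forall>(l, d) \<in> B. u \<in> uppers \<longrightarrow> l \<in> lowers \<longrightarrow> \<not> clash u l c d)"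

definition upper_ends :: "(cmp \<times> rat) set \<Rightarrow> rat set" where
  "upper_ends B = {c. \<exists>u \<in> uppers. (u, c) \<in> B}"

definition lower_ends :: "(cmp \<times> rat) set \<Rightarrow> rat set" where
  "lower_ends B = {c. \<exists>l \<in> lowers. (l, c) \<in> B}"

definition bounds_midpoint :: "(cmp \<times> rat) set \<Rightarrow> rat" where
  "bounds_midpoint B = (Max (lower_ends B) + Min (upper_ends B)) / 2"

lemma consistent_boundsD:
  assumes "consistent_bounds B" "(u, c) \<in> B" "(l, d) \<in> B" "u \<in> uppers" "l \<in> lowers"
  shows "\<not> clash u l c d"
  using assms unfolding consistent_bounds_def by blast

lemma finite_ends:
  assumes "finite B"
  shows "finite (upper_ends B)" "finite (lower_ends B)"
proof -
  have "upper_ends B \<subseteq> snd ` B" "lower_ends B \<subseteq> snd ` B"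
    unfolding upper_ends_def lower_ends_def by force+
  then show "finite (upper_ends B)" "finite (lower_ends B)"
    using assms by (auto intro: finite_subset)
qed

lemma holds_bounds_midpoint:
  assumes "finite B" "consistent_bounds B" "upper_ends B \<noteq> {}" "lower_ends B \<noteq> {}"
    and mem: "(b, c) \<in> B"
  shows "holds b (bounds_midpoint B) c"
proof -
  define U where "U = Min (upper_ends B)"
  define L where "L = Max (lower_ends B)"
  note finite_ends = finite_ends[OF assms(1)]
  obtain u where u: "u \<in> uppers" "(u, U) \<in> B"
    using Min_in[OF finite_ends(1) assms(3)] unfolding U_def upper_ends_def by blast
  obtain l where l: "l \<in> lowers" "(l, L) \<in> B"
    using Max_in[OF finite_ends(2) assms(4)] unfolding L_def lower_ends_def by blast
  note consistent = consistent_boundsD[OF assms(2)]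
  have "L \<le> U"
    using consistent[OF u(2) l(2) u(1) l(1)] u(1) l(1) by (auto simp: not_clash_iff)
  show ?thesis
  proof (cases b rule: upper_lower_cases)
    case upper
    then have "U \<le> c"
      using mem finite_ends(1) unfolding U_def upper_ends_def by (intro Min_le) auto
    moreover have "\<not> clash b l c L"
      using mem l(2) upper l(1) by (rule consistent)
    ultimately show ?thesis
      using \<open>L \<le> U\<close> upper l(1)
      by (auto simp: not_clash_iff bounds_midpoint_def simp flip: U_def L_def)
  next
    case lower
    then have "c \<le> L"
      using mem finite_ends(2) unfolding L_def lower_ends_def by (intro Max_ge) auto
    moreover have "\<not> clash u b U c"
      using u(2) mem u(1) lower by (rule consistent)
    ultimately show ?thesis
      using \<open>L \<le> U\<close> lower u(1)
      by (auto simp: not_clash_iff bounds_midpoint_def simp flip: U_def L_def)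
  qed
qed

definition unit_bounds :: "(cmp \<times> rat) set" where
  "unit_bounds = {(Ge, 0), (Le, 1)}"

definition unit_consistent :: "(cmp \<times> rat) set \<Rightarrow> bool" where
  "unit_consistent B \<longleftrightarrow> consistent_bounds (unit_bounds \<union> B)"

definition unit_value :: "(cmp \<times> rat) set \<Rightarrow> real" where
  "unit_value B = of_rat (bounds_midpoint (unit_bounds \<union> B))"

lemma unit_consistentI:
  assumes "\<And>u c l d. (u, c) \<in> B \<Longrightarrow> (l, d) \<in> B \<Longrightarrow> u \<in> uppers \<Longrightarrow> l \<in> lowers \<Longrightarrow> \<not> clash u l c d"
    and "\<And>u c. (u, c) \<in> B \<Longrightarrow> u \<in> uppers \<Longrightarrow> holds u 0 c"
    and "\<And>l c. (l, c) \<in> B \<Longrightarrow> l \<in> lowers \<Longrightarrow> holds l 1 c"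
  shows "unit_consistent B"
proof -
  have "\<not> clash u Ge c 0" if "(u, c) \<in> B" "u \<in> uppers" for u c
    using assms(2)[OF that] that(2) by (auto simp: not_clash_iff)
  moreover have "\<not> clash Le l 1 c" if "(l, c) \<in> B" "l \<in> lowers" for l c
    using assms(3)[OF that] that(2) by (auto simp: not_clash_iff)
  moreover have "\<not> clash Le Ge 1 0" by (simp add: clash_def)
  ultimately show ?thesis
    using assms(1) unfolding unit_consistent_def consistent_bounds_def unit_bounds_def by blast
qed

lemma
  assumes "finite B" "unit_consistent B"
  shows holds_unit_value: "(b, c) \<in> B \<Longrightarrow> holds b (unit_value B) (of_rat c)"
    and unit_value_mem_unit: "unit_value B \<in> {0..1}"
proof -
  have "upper_ends (unit_bounds \<union> B) \<noteq> {}" "lower_ends (unit_bounds \<union> B) \<noteq> {}"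
    by (auto simp: upper_ends_def lower_ends_def unit_bounds_def)
  then have midpoint: "holds b (bounds_midpoint (unit_bounds \<union> B)) c"
    if "(b, c) \<in> unit_bounds \<union> B" for b c
    using assms that
    by (intro holds_bounds_midpoint) (simp_all add: unit_consistent_def unit_bounds_def)
  show "holds b (unit_value B) (of_rat c)" if "(b, c) \<in> B"
    using midpoint[of b c] that by (simp add: unit_value_def)
  show "unit_value B \<in> {0..1}"
    using midpoint[of Ge 0] midpoint[of Le 1] by (simp add: unit_value_def unit_bounds_def)
qed


section \<open>Propositional rules\<close>

inductive expands :: "('p, 'r) assertion \<Rightarrow> ('p, 'r) assertion set \<Rightarrow> bool" where
  "l \<in> lowers \<Longrightarrow> expands (Conj C D, l, c) {(C, l, c), (D, l, c)}"
| "u \<in> uppers \<Longrightarrow> expands (Conj C D, u, c) {(C, u, c)}"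
| "u \<in> uppers \<Longrightarrow> expands (Conj C D, u, c) {(D, u, c)}"
| "expands (Neg C, b, c) {(C, rev_cmp b, 1 - c)}"
| "u \<in> uppers \<Longrightarrow> expands (Ominus C c, u, d) {(C, u, d + c), (Const d, rev_cmp u, 0)}"
| "l \<in> lowers \<Longrightarrow> nontrivial_lower l d \<Longrightarrow> expands (Ominus C c, l, d) {(C, l, d + c)}"

lemma prop_rule_expandsE:
  assumes "prop_rule P Q" "Seq P' \<in> Q"
  obtains A S N where "expands A N" "A \<notin> S" "P = insert A S" "P' = S \<union> N"
  using assms
proof cases
  case (Conj_lower l C D c S)
  then show thesis
    using assms(2) that[of "(Conj C D, l, c)" "{(C, l, c), (D, l, c)}" S]
    by (simp add: expands.intros)
next
  case (Conj_upper u C D c S)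
  then show thesis
    using assms(2) that[of "(Conj C D, u, c)" "{(C, u, c)}" S]
      that[of "(Conj C D, u, c)" "{(D, u, c)}" S]
    by (auto simp: expands.intros)
next
  case (Neg_cmp C b c S)
  then show thesis
    using assms(2) that[of "(Neg C, b, c)" "{(C, rev_cmp b, 1 - c)}" S]
    by (simp add: expands.intros)
next
  case (Ominus_upper u C c d S)
  then show thesis
    using assms(2) that[of "(Ominus C c, u, d)" "{(C, u, d + c), (Const d, rev_cmp u, 0)}" S]
    by (simp add: expands.intros)
next
  case (Ominus_lower l d C c S)
  then show thesis
    using assms(2) that[of "(Ominus C c, l, d)" "{(C, l, d + c)}" S]
    by (simp add: expands.intros)
qed auto

lemma expands_prop_rule:
  assumes "expands A N" "A \<in> P"
  shows "\<exists>Q. prop_rule P Q"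
proof -
  obtain S where S: "P = insert A S" "A \<notin> S"
    using assms(2) by (meson mk_disjoint_insert)
  show ?thesis
    unfolding S(1) using assms(1) S(2)
    by cases (auto intro: prop_rule.intros)
qed

lemma expands_sat_assertion:
  assumes "expands A N" "\<forall>B \<in> N. sat_assertion I x B"
  shows "sat_assertion I x A"
  using assms
  by cases
    (auto simp: holds_lower_min holds_upper_min holds_lower_max holds_upper_max
      holds_diff_left holds_one_minus_left of_rat_diff of_rat_add nontrivial_lower_iff add.commute
      simp del: holds.simps)

lemma not_expands_Atom: "\<not> expands (Atom p, b, c) N"
  and not_expands_ExR: "\<not> expands (ExR R C, b, c) N"
  by (auto elim: expands.cases)

primrec concept_weight :: "('p, 'r) concept \<Rightarrow> nat" where
  "concept_weight (Atom p) = 0"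
| "concept_weight (Const c) = 0"
| "concept_weight (Neg C) = Suc (concept_weight C)"
| "concept_weight (Ominus C c) = Suc (concept_weight C)"
| "concept_weight (Conj C D) = Suc (concept_weight C + concept_weight D)"
| "concept_weight (ExR R C) = Suc (concept_weight C)"

definition sequent_weight :: "('p, 'r) assertion set \<Rightarrow> nat" where
  "sequent_weight P = (\<Sum>A \<in> P. concept_weight (fst A))"

lemma expands_finite: "expands A N \<Longrightarrow> finite N"
  by (auto elim: expands.cases)

lemma expands_weight_less: "expands A N \<Longrightarrow> sequent_weight N < concept_weight (fst A)"
  by (erule expands.cases) (auto simp: sequent_weight_def sum.insert_if)

lemma prop_rule_weight_less:
  assumes "prop_rule P Q" "Seq P' \<in> Q" "finite P"
  shows "sequent_weight P' < sequent_weight P"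
  using assms(1,2)
proof (rule prop_rule_expandsE)
  fix A S N
  assume step: "expands A N" "A \<notin> S" "P = insert A S" "P' = S \<union> N"
  then have "finite S" "finite N" using assms(3) by (auto intro: expands_finite)
  then have "sequent_weight P' \<le> sequent_weight S + sequent_weight N"
    by (simp add: step(4) sequent_weight_def sum_Un_nat)
  also have "\<dots> < sequent_weight S + concept_weight (fst A)"
    using expands_weight_less[OF step(1)] by simp
  also have "\<dots> = sequent_weight P"
    using step(2,3) \<open>finite S\<close> by (simp add: sequent_weight_def)
  finally show ?thesis .
qed


section \<open>The sequents of a tableau\<close>

lemma wf_concept_simps [simp]:
  "wf_concept (Neg C) \<longleftrightarrow> wf_concept C"
  "wf_concept (Ominus C c) \<longleftrightarrow> c \<in> {0..1} \<and> wf_concept C"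
  "wf_concept (Conj C D) \<longleftrightarrow> wf_concept C \<and> wf_concept D"
  "wf_concept (ExR R C) \<longleftrightarrow> wf_concept C"
  "wf_concept (Const c) \<longleftrightarrow> c \<in> {0..1}"
  by (auto simp: wf_concept_def)

(* The rule for C \<ominus> c \<triangleleft> d introduces constants d that may lie outside the unit interval. *)
definition tableau_sequent :: "('p, 'r) assertion set \<Rightarrow> bool" where
  "tableau_sequent P \<longleftrightarrow> finite P \<and> (\<forall>(C, b, c) \<in> P. wf_concept C \<or> (\<exists>d. C = Const d))"

lemma tableau_sequent_finite: "tableau_sequent P \<Longrightarrow> finite P"
  by (simp add: tableau_sequent_def)

lemma tableau_sequent_ExR: "tableau_sequent P \<Longrightarrow> (ExR R C, b, c) \<in> P \<Longrightarrow> wf_concept C"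
  by (fastforce simp: tableau_sequent_def)

lemma tableau_sequent_subset: "tableau_sequent P \<Longrightarrow> Q \<subseteq> P \<Longrightarrow> tableau_sequent Q"
  by (auto simp: tableau_sequent_def intro: finite_subset)

lemma tableau_sequent_Un: "tableau_sequent P \<Longrightarrow> tableau_sequent Q \<Longrightarrow> tableau_sequent (P \<union> Q)"
  by (auto simp: tableau_sequent_def)

lemma expands_tableau_sequent: "expands A N \<Longrightarrow> tableau_sequent {A} \<Longrightarrow> tableau_sequent N"
  by (erule expands.cases) (auto simp: tableau_sequent_def)

lemma prop_rule_tableau_sequent:
  assumes "prop_rule P Q" "Seq P' \<in> Q" "tableau_sequent P"
  shows "tableau_sequent P'"
  using assms(1,2)
proof (rule prop_rule_expandsE)
  fix A S N
  assume step: "expands A N" "P = insert A S" "P' = S \<union> N"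
  then have "tableau_sequent {A}" "tableau_sequent S"
    using assms(3) by (auto intro: tableau_sequent_subset)
  from step(1) this(1) have "tableau_sequent N" by (rule expands_tableau_sequent)
  with \<open>tableau_sequent S\<close> show ?thesis unfolding step(3) by (rule tableau_sequent_Un)
qed

definition ex_assertions :: "('p, 'r) assertion set \<Rightarrow> ('r \<times> ('p, 'r) concept \<times> cmp \<times> rat) set" where
  "ex_assertions P = {(R, C, b, c). (ExR R C, b, c) \<in> P}"

definition ex_conclusion ::
    "('p, 'r) concept \<Rightarrow> ('p, 'r) assertion set \<Rightarrow> 'r \<Rightarrow> ('p, 'r) concept \<Rightarrow> cmp \<Rightarrow> rat
      \<Rightarrow> ('p, 'r) assertion set" where
  "ex_conclusion T P R C l c =
     {(D, u, d) | D u d. (ExR R D, u, d) \<in> P \<and> u \<in> uppers \<and> clash u l d c}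
       \<union> {(C, l, c), (T, Ge, 1)}"

lemma ex_rule_iff:
  "ex_rule T P Q \<longleftrightarrow>
     (\<exists>R C l c. (ExR R C, l, c) \<in> P \<and> nontrivial_lower l c \<and> Q = ex_conclusion T P R C l c)"
  unfolding ex_rule.simps ex_conclusion_def[symmetric]
  by (auto simp: nontrivial_lower_iff)

lemma ex_rule_insert:
  assumes "\<And>R C. fst A \<noteq> ExR R C"
  shows "ex_rule T (insert A P) Q \<longleftrightarrow> ex_rule T P Q"
proof -
  have "(ExR R D, u, d) \<in> insert A P \<longleftrightarrow> (ExR R D, u, d) \<in> P" for R D u d
    using assms[of R D] by auto
  then show ?thesis by (simp only: ex_rule_iff ex_conclusion_def)
qed

lemma finite_ex_assertions:
  assumes "finite P"
  shows "finite (ex_assertions P)"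
proof -
  have "ex_assertions P = (\<lambda>(R, C, b, c). (ExR R C, b, c)) -` P"
    by (auto simp: ex_assertions_def)
  also have "finite \<dots>"
    using assms by (rule finite_vimageI) (auto simp: inj_def)
  finally show ?thesis .
qed

lemma finite_ex_conclusion:
  assumes "finite P"
  shows "finite (ex_conclusion T P R C l c)"
proof -
  have "finite {(D, u, d) | D u d. (ExR R D, u, d) \<in> P \<and> u \<in> uppers \<and> clash u l d c}"
  proof (rule finite_subset)
    show "{(D, u, d) | D u d. (ExR R D, u, d) \<in> P \<and> u \<in> uppers \<and> clash u l d c}
        \<subseteq> Range (ex_assertions P)"
      by (auto simp: ex_assertions_def Range_iff)
    show "finite (Range (ex_assertions P))"
      by (intro finite_Range finite_ex_assertions assms)
  qed
  then show ?thesis by (simp add: ex_conclusion_def)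
qed

lemma finite_ex_rule:
  assumes "finite P"
  shows "finite {Q. ex_rule T P Q}"
proof (rule finite_subset)
  show "{Q. ex_rule T P Q} \<subseteq> (\<lambda>(R, C, l, c). ex_conclusion T P R C l c) ` ex_assertions P"
  proof
    fix Q assume "Q \<in> {Q. ex_rule T P Q}"
    then obtain R C l c where "(R, C, l, c) \<in> ex_assertions P" "Q = ex_conclusion T P R C l c"
      by (auto simp: ex_rule_iff ex_assertions_def)
    then show "Q \<in> (\<lambda>(R, C, l, c). ex_conclusion T P R C l c) ` ex_assertions P" by force
  qed
qed (simp add: finite_ex_assertions assms)

lemma ex_rule_tableau_sequent:
  assumes "ex_rule T P Q" "tableau_sequent P" "wf_concept T"
  shows "tableau_sequent Q"
proof -
  from assms(1) obtain R C l c where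
    Q: "Q = ex_conclusion T P R C l c" and ExR: "(ExR R C, l, c) \<in> P"
    unfolding ex_rule_iff by auto
  have "finite Q"
    unfolding Q using tableau_sequent_finite[OF assms(2)] by (rule finite_ex_conclusion)
  moreover have "wf_concept D" if "(D, b, d) \<in> Q" for D b d
    using that ExR assms(3) unfolding Q ex_conclusion_def
    by (auto intro: tableau_sequent_ExR[OF assms(2)])
  ultimately show ?thesis by (auto simp: tableau_sequent_def)
qed


section \<open>Hintikka sets\<close>

definition atom_bounds :: "('p, 'r) assertion set \<Rightarrow> 'p \<Rightarrow> (cmp \<times> rat) set" where
  "atom_bounds H p = {(b, c). (Atom p, b, c) \<in> H}"

lemma finite_atom_bounds:
  assumes "finite H"
  shows "finite (atom_bounds H p)"
proof -
  have "atom_bounds H p \<subseteq> snd ` H" by (force simp: atom_bounds_def)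
  then show ?thesis using assms finite_subset by blast
qed

fun irreducible :: "('p, 'r) assertion \<Rightarrow> bool" where
  "irreducible (Atom p, b, c) \<longleftrightarrow> True"
| "irreducible (Const d, b, c) \<longleftrightarrow> holds b d c"
| "irreducible (Neg C, b, c) \<longleftrightarrow> False"
| "irreducible (Ominus C d, b, c) \<longleftrightarrow> b \<in> lowers \<and> holds b 0 c"
| "irreducible (Conj C D, b, c) \<longleftrightarrow> False"
| "irreducible (ExR R C, b, c) \<longleftrightarrow> (b \<in> uppers \<longrightarrow> holds b 0 c)"

definition hintikka :: "('p, 'r) assertion set \<Rightarrow> bool" where
  "hintikka H \<longleftrightarrow>
     (\<forall>A \<in> H. irreducible A \<or> (\<exists>N \<subseteq> H. expands A N)) \<and>
     (\<forall>p. unit_consistent (atom_bounds H p))"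

lemma hintikka_ExR_upper:
  assumes "hintikka H" "(ExR R C, u, c) \<in> H" "u \<in> uppers"
  shows "holds u 0 c"
proof -
  have "irreducible (ExR R C, u, c) \<or> (\<exists>N. expands (ExR R C, u, c) N)"
    using assms(1,2) unfolding hintikka_def by blast
  then have "irreducible (ExR R C, u, c)" by (simp only: not_expands_ExR simp_thms)
  then show ?thesis using assms(3) by auto
qed

lemma hintikka_insert:
  assumes "hintikka H" "expands A N" "N \<subseteq> H"
  shows "hintikka (insert A H)"
proof -
  have "atom_bounds (insert A H) p = atom_bounds H p" for p
    using assms(2) by (auto simp: atom_bounds_def not_expands_Atom)
  then have "\<forall>p. unit_consistent (atom_bounds (insert A H) p)"
    using assms(1) by (simp add: hintikka_def)
  moreover have "\<exists>N \<subseteq> insert A H. expands A N"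
    using assms(2,3) by (intro exI[of _ N]) auto
  moreover have "irreducible B \<or> (\<exists>N \<subseteq> insert A H. expands B N)" if "B \<in> H" for B
    using assms(1) that unfolding hintikka_def by (meson subset_insertI2)
  ultimately show ?thesis by (simp add: hintikka_def)
qed

lemma saturated_unit_consistent_atom_bounds:
  assumes "saturated (Seq P)"
  shows "unit_consistent (atom_bounds P p)"
proof -
  have no_rule: "\<not> prop_rule P Q" for Q
    using assms by (simp add: saturated_def)
  show ?thesis
  proof (rule unit_consistentI; unfold atom_bounds_def mem_Collect_eq case_prod_conv)
    show "\<not> clash u l c d"
      if "(Atom p, u, c) \<in> P" "(Atom p, l, d) \<in> P" "u \<in> uppers" "l \<in> lowers" for u c l d
      using Ax_p[of u l c d p P] that no_rule by (auto simp: insert_absorb)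
    show "holds u 0 c" if "(Atom p, u, c) \<in> P" "u \<in> uppers" for u c
      using Ax_0[of u c p P] that no_rule by (fastforce simp: insert_absorb)
    show "holds l 1 c" if "(Atom p, l, c) \<in> P" "l \<in> lowers" for l c
      using Ax_1[of l c p P] that no_rule by (fastforce simp: insert_absorb)
  qed
qed

lemma saturated_irreducible:
  assumes "saturated (Seq P)" "A \<in> P"
  shows "irreducible A"
proof -
  have no_rule: "\<not> prop_rule P Q" for Q
    using assms(1) by (simp add: saturated_def)
  then have no_expansion: "\<not> expands A N" for N
    using expands_prop_rule assms(2) by blast
  then show ?thesis
  proof (cases A rule: irreducible.cases)
    case (2 d b c)
    then show ?thesis
      using Ax_c[of b d c P] no_rule assms(2) by (auto simp: insert_absorb)
  next
    case (4 C d b c)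
    then have "b \<notin> uppers" "\<not> (b \<in> lowers \<and> nontrivial_lower b c)"
      using no_expansion by (auto intro: expands.intros)
    then show ?thesis unfolding 4 nontrivial_lower_iff by (cases b) auto
  next
    case (5 C D b c)
    then show ?thesis
      using no_expansion by (cases b rule: upper_lower_cases) (auto intro: expands.intros)
  next
    case (6 R C b c)
    then show ?thesis
      using Ax_0_ex[of b c R C P] no_rule assms(2)
      by (fastforce simp: insert_absorb)
  qed (auto intro: expands.intros)
qed

lemma hintikka_saturated: "saturated (Seq P) \<Longrightarrow> hintikka P"
  by (simp add: hintikka_def saturated_irreducible saturated_unit_consistent_atom_bounds)


section \<open>Values of concepts in the unit interval\<close>

lemma cSUP_mem_unit:
  fixes f :: "'a \<Rightarrow> real"
  assumes "X \<noteq> {}" "\<And>x. x \<in> X \<Longrightarrow> f x \<in> {0..1}"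
  shows "(SUP x \<in> X. f x) \<in> {0..1}"
proof -
  obtain x where x: "x \<in> X" using assms(1) by blast
  have "bdd_above (f ` X)" using assms(2) by (intro bdd_aboveI2[of _ _ 1]) simp
  then have "0 \<le> (SUP x \<in> X. f x)"
    using x assms(2) by (intro cSUP_upper2[OF _ x]) auto
  moreover have "(SUP x \<in> X. f x) \<le> 1"
    using assms by (intro cSUP_least) auto
  ultimately show ?thesis by simp
qed

lemma ceval_mem_unit:
  assumes "interpretation_ok I" "wf_concept C" "x \<in> indivs I"
  shows "ceval I C x \<in> {0..1}"
  using assms(2,3)
proof (induction C arbitrary: x)
  case (Atom p)
  then show ?case using assms(1) by (auto simp: interpretation_ok_def)
next
  case (Const c)
  then show ?case by simp
next
  case (Neg C)
  then show ?case by fastforce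
next
  case (Ominus C c)
  then have "ceval I C x \<in> {0..1}" by simp
  moreover have "(0 :: real) \<le> of_rat c" using Ominus.prems by simp
  ultimately show ?case by (simp del: zero_le_of_rat_iff)
next
  case (Conj C D)
  then have "ceval I C x \<in> {0..1}" "ceval I D x \<in> {0..1}" by simp_all
  then show ?case by (simp add: min_def)
next
  case (ExR R C)
  have "min (role_val I R x y) (ceval I C y) \<in> {0..1}" if "y \<in> indivs I" for y
    using ExR that assms(1) by (auto simp: interpretation_ok_def min_def)
  then show ?case
    using assms(1) unfolding ceval.simps
    by (intro cSUP_mem_unit) (simp_all add: interpretation_ok_def)
qed


section \<open>The model of a family of Hintikka sets\<close>

definition role_bounds :: "('p, 'r) assertion set \<Rightarrow> 'r \<Rightarrow> cmp \<Rightarrow> rat \<Rightarrow> (cmp \<times> rat) set" where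
  "role_bounds P R l c =
     insert (l, c) {(u, d). \<exists>D. (ExR R D, u, d) \<in> P \<and> u \<in> uppers \<and> \<not> clash u l d c}"

lemma finite_role_bounds:
  assumes "finite P"
  shows "finite (role_bounds P R l c)"
proof -
  have "role_bounds P R l c \<subseteq> insert (l, c) (snd ` P)" by (force simp: role_bounds_def)
  then show ?thesis using assms finite_subset by blast
qed

lemma hintikka_unit_consistent_role_bounds:
  assumes "hintikka P" "l \<in> lowers" "holds l 1 c"
  shows "unit_consistent (role_bounds P R l c)"
proof (rule unit_consistentI)
  have upper: "\<exists>D. (ExR R D, u, d) \<in> P \<and> \<not> clash u l d c"
    if "(u, d) \<in> role_bounds P R l c" "u \<in> uppers" for u d
    using that assms(2) by (auto simp: role_bounds_def)
  have lower: "l' = l \<and> d = c" if "(l', d) \<in> role_bounds P R l c" "l' \<in> lowers" for l' d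
    using that by (auto simp: role_bounds_def)
  show "\<not> clash u l' d d'"
    if "(u, d) \<in> role_bounds P R l c" "(l', d') \<in> role_bounds P R l c"
      "u \<in> uppers" "l' \<in> lowers" for u d l' d'
    using upper[OF that(1,3)] lower[OF that(2,4)] by blast
  show "holds u 0 d" if "(u, d) \<in> role_bounds P R l c" "u \<in> uppers" for u d
    using upper[OF that] hintikka_ExR_upper[OF assms(1)] that(2) by blast
  show "holds l' 1 d" if "(l', d) \<in> role_bounds P R l c" "l' \<in> lowers" for l' d
    using lower[OF that] assms(3) by simp
qed

locale hintikka_family =
  fixes T :: "('p, 'r) concept" and I :: "'i set" and H :: "'i \<Rightarrow> ('p, 'r) assertion set"
  assumes nonempty: "I \<noteq> {}"
    and tableau_sequent: "x \<in> I \<Longrightarrow> tableau_sequent (H x)"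
    and hintikka: "x \<in> I \<Longrightarrow> hintikka (H x)"
    and T_mem: "x \<in> I \<Longrightarrow> (T, Ge, 1) \<in> H x"
    and successor_exists: "x \<in> I \<Longrightarrow> ex_rule T (H x) Q \<Longrightarrow> \<exists>y \<in> I. Q \<subseteq> H y"
begin

lemma finite_H: "x \<in> I \<Longrightarrow> finite (H x)"
  by (rule tableau_sequent_finite[OF tableau_sequent])

definition successor :: "'i \<Rightarrow> 'r \<Rightarrow> ('p, 'r) concept \<Rightarrow> cmp \<Rightarrow> rat \<Rightarrow> 'i" where
  "successor x R C l c = (SOME y. y \<in> I \<and> ex_conclusion T (H x) R C l c \<subseteq> H y)"

(* No value in the unit interval meets the bound unless holds l 1 c. The restriction costs
   nothing: C itself has to meet the bound at the successor. *)
definition edge :: "'r \<Rightarrow> 'i \<Rightarrow> 'i \<Rightarrow> cmp \<Rightarrow> rat \<Rightarrow> bool" where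
  "edge R x y l c \<longleftrightarrow>
     (\<exists>C. (ExR R C, l, c) \<in> H x \<and> nontrivial_lower l c \<and> holds l 1 c \<and> y = successor x R C l c)"

definition edge_value :: "'r \<Rightarrow> 'i \<Rightarrow> cmp \<Rightarrow> rat \<Rightarrow> real" where
  "edge_value R x l c = unit_value (role_bounds (H x) R l c)"

(* Several existential assertions may share a successor; each of them alone already respects
   all upper bounds on the role, so the maximum of their values does too. *)
definition role_value :: "'r \<Rightarrow> 'i \<Rightarrow> 'i \<Rightarrow> real" where
  "role_value R x y = Max (insert 0 {edge_value R x l c | l c. edge R x y l c})"

definition model :: "('i, 'p, 'r) interp" where
  "model = \<lparr>indivs = I, atom_val = (\<lambda>p x. unit_value (atom_bounds (H x) p)),
     role_val = role_value\<rparr>"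

lemma successor_spec:
  assumes "x \<in> I" "(ExR R C, l, c) \<in> H x" "nontrivial_lower l c"
  shows "successor x R C l c \<in> I \<and> ex_conclusion T (H x) R C l c \<subseteq> H (successor x R C l c)"
  unfolding successor_def
proof (rule someI_ex)
  have "ex_rule T (H x) (ex_conclusion T (H x) R C l c)"
    using assms(2,3) by (auto simp: ex_rule_iff)
  then show "\<exists>y. y \<in> I \<and> ex_conclusion T (H x) R C l c \<subseteq> H y"
    using successor_exists[OF assms(1)] by blast
qed

lemma finite_edge_values:
  assumes "x \<in> I"
  shows "finite {edge_value R x l c | l c. edge R x y l c}"
proof -
  have "{edge_value R x l c | l c. edge R x y l c} \<subseteq> (\<lambda>(C, l, c). edge_value R x l c) ` H x"
    by (force simp: edge_def)
  then show ?thesis using finite_H[OF assms] finite_subset by blast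
qed

lemma finite_edge_targets:
  assumes "x \<in> I"
  shows "finite {y. \<exists>l c. edge R x y l c}"
proof -
  have "{y. \<exists>l c. edge R x y l c} \<subseteq> (\<lambda>(R, C, l, c). successor x R C l c) ` ex_assertions (H x)"
    by (force simp: edge_def ex_assertions_def)
  then show ?thesis
    by (rule finite_subset) (simp add: finite_ex_assertions finite_H assms)
qed

lemma role_value_cases:
  assumes "x \<in> I"
  obtains (zero) "role_value R x y = 0"
    | (edge) l c where "edge R x y l c" "role_value R x y = edge_value R x l c"
  using Max_in[of "insert 0 {edge_value R x l c | l c. edge R x y l c}"]
    finite_edge_values[OF assms, of R y]
  by (auto simp: role_value_def)

lemma role_value_no_edge: "\<nexists>l c. edge R x y l c \<Longrightarrow> role_value R x y = 0"
  by (simp add: role_value_def)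

lemma edge_unit_consistent_role_bounds:
  assumes "x \<in> I" "edge R x y l c"
  shows "unit_consistent (role_bounds (H x) R l c)"
  using assms
  by (intro hintikka_unit_consistent_role_bounds hintikka) (auto simp: edge_def nontrivial_lower_iff)

lemma holds_edge_value:
  assumes "x \<in> I" "edge R x y l c" "(b, d) \<in> role_bounds (H x) R l c"
  shows "holds b (edge_value R x l c) (of_rat d)"
  unfolding edge_value_def
  using finite_role_bounds[OF finite_H] edge_unit_consistent_role_bounds assms
  by (intro holds_unit_value)

lemma role_value_mem_unit:
  assumes "x \<in> I"
  shows "role_value R x y \<in> {0..1}"
  using assms
proof (cases rule: role_value_cases[of x R y])
  case (edge l c)
  then show ?thesis
    using assms
      unit_value_mem_unit[OF finite_role_bounds[OF finite_H] edge_unit_consistent_role_bounds]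
    by (simp add: edge_value_def)
qed simp

lemma role_value_upper:
  assumes "x \<in> I" and ExR: "(ExR R D, u, d) \<in> H x" "u \<in> uppers"
  shows "(D, u, d) \<in> H y \<or> holds u (role_value R x y) (of_rat d)"
  using assms(1)
proof (cases rule: role_value_cases[of x R y])
  case zero
  then show ?thesis using hintikka_ExR_upper[OF hintikka] assms by simp
next
  case (edge l c)
  show ?thesis
  proof (cases "clash u l d c")
    case True
    obtain C where "(ExR R C, l, c) \<in> H x" "nontrivial_lower l c" "y = successor x R C l c"
      using edge(1) by (auto simp: edge_def)
    then have "ex_conclusion T (H x) R C l c \<subseteq> H y"
      using successor_spec[OF assms(1)] by blast
    then show ?thesis using True ExR by (auto simp: ex_conclusion_def)
  next
    case False
    then have "(u, d) \<in> role_bounds (H x) R l c"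
      using ExR by (auto simp: role_bounds_def)
    then show ?thesis using holds_edge_value[OF assms(1) edge(1)] edge(2) by simp
  qed
qed

lemma role_value_lower:
  assumes "x \<in> I" "edge R x y l c"
  shows "holds l (role_value R x y) (of_rat c)"
proof (rule holds_lower_mono)
  show "l \<in> lowers" using assms(2) by (auto simp: edge_def nontrivial_lower_iff)
  show "holds l (edge_value R x l c) (of_rat c)"
    using assms by (rule holds_edge_value) (simp add: role_bounds_def)
  show "edge_value R x l c \<le> role_value R x y"
    using finite_edge_values[OF assms(1)] assms(2) unfolding role_value_def by (intro Max_ge) auto
qed

lemma model_simps [simp]:
  "indivs model = I"
  "atom_val model p x = unit_value (atom_bounds (H x) p)"
  "role_val model = role_value"
  by (simp_all add: model_def)

lemma unit_consistent_atom_bounds: "x \<in> I \<Longrightarrow> unit_consistent (atom_bounds (H x) p)"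
  using hintikka by (simp add: hintikka_def)

lemma interpretation_ok_model: "interpretation_ok model"
  using nonempty role_value_mem_unit
    unit_value_mem_unit[OF finite_atom_bounds[OF finite_H] unit_consistent_atom_bounds]
  unfolding interpretation_ok_def by simp

lemma ceval_model_mem_unit: "wf_concept C \<Longrightarrow> x \<in> I \<Longrightarrow> ceval model C x \<in> {0..1}"
  using ceval_mem_unit[OF interpretation_ok_model] by simp

(* Strict upper bounds survive the supremum because only finitely many values occur. *)
lemma ceval_ExR_upper:
  assumes x: "x \<in> I" and ExR: "(ExR R C, u, d) \<in> H x" "u \<in> uppers"
    and subconcept: "\<And>y. y \<in> I \<Longrightarrow> (C, u, d) \<in> H y \<Longrightarrow> holds u (ceval model C y) (of_rat d)"
  shows "holds u (ceval model (ExR R C) x) (of_rat d)"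
proof -
  let ?value = "\<lambda>y. min (role_value R x y) (ceval model C y)"
  have wf: "wf_concept C" using tableau_sequent_ExR[OF tableau_sequent[OF x] ExR(1)] .
  have "?value y = 0" if "y \<in> I" "\<nexists>l c. edge R x y l c" for y
    using role_value_no_edge[OF that(2)] ceval_model_mem_unit[OF wf that(1)] by simp
  then have "?value ` I \<subseteq> insert 0 (?value ` {y. \<exists>l c. edge R x y l c})" by blast
  then have "finite (?value ` I)"
    using finite_edge_targets[OF x] by (meson finite_imageI finite_insert finite_subset)
  moreover have "holds u (?value y) (of_rat d)" if "y \<in> I" for y
    using role_value_upper[OF x ExR, of y] subconcept[OF that] holds_upper_min[OF ExR(2)] by blast
  ultimately show ?thesis
    using nonempty by (simp del: holds.simps add: holds_finite_SUP)
qed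

lemma ceval_ExR_ge:
  assumes "x \<in> I" "y \<in> I"
  shows "min (role_value R x y) (ceval model C y) \<le> ceval model (ExR R C) x"
proof -
  have "min (role_value R x z) (ceval model C z) \<le> 1" for z
    using role_value_mem_unit[OF assms(1), of R z] by (simp add: min_le_iff_disj)
  then show ?thesis
    using assms(2) by (auto intro!: cSUP_upper bdd_aboveI2)
qed

lemma ceval_ExR_lower:
  assumes x: "x \<in> I" and ExR: "(ExR R C, l, c) \<in> H x" "l \<in> lowers"
    and subconcept: "\<And>y. y \<in> I \<Longrightarrow> (C, l, c) \<in> H y \<Longrightarrow> holds l (ceval model C y) (of_rat c)"
  shows "holds l (ceval model (ExR R C) x) (of_rat c)"
proof -
  have wf: "wf_concept C" using tableau_sequent_ExR[OF tableau_sequent[OF x] ExR(1)] .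
  show ?thesis
  proof (cases "nontrivial_lower l c")
    case False
    then have "holds l (0 :: real) (of_rat c)" using ExR(2) nontrivial_lower_iff by auto
    moreover have "0 \<le> ceval model (ExR R C) x"
      using ceval_model_mem_unit[of "ExR R C"] wf x by simp
    ultimately show ?thesis by (rule holds_lower_mono[OF ExR(2)])
  next
    case True
    define y where "y = successor x R C l c"
    have y: "y \<in> I" "(C, l, c) \<in> H y"
      using successor_spec[OF x ExR(1) True] by (auto simp: y_def ex_conclusion_def)
    have witness: "holds l (ceval model C y) (of_rat c)" by (rule subconcept[OF y])
    then have "holds l (1 :: real) (of_rat c)"
      by (rule holds_lower_mono[OF ExR(2)]) (use ceval_model_mem_unit[OF wf y(1)] in simp)
    then have "edge R x y l c" using ExR(1) True by (auto simp: edge_def y_def)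
    then have "holds l (min (role_value R x y) (ceval model C y)) (of_rat c)"
      using role_value_lower[OF x] witness by (simp add: holds_lower_min[OF ExR(2)])
    then show ?thesis using ceval_ExR_ge[OF x y(1)] by (rule holds_lower_mono[OF ExR(2)])
  qed
qed

lemma sat_assertion_model:
  assumes "x \<in> I" "A \<in> H x"
  shows "sat_assertion model x A"
  using assms
proof (induction "concept_weight (fst A)" arbitrary: x A rule: less_induct)
  case less
  consider (expand) N where "N \<subseteq> H x" "expands A N" | (irreducible) "irreducible A"
    using hintikka[OF less.prems(1)] less.prems(2) by (auto simp: hintikka_def)
  then show ?case
  proof cases
    case expand
    have "sat_assertion model x B" if "B \<in> N" for B
    proof (rule less.hyps[OF _ less.prems(1)])
      have "concept_weight (fst B) \<le> sequent_weight N"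
        unfolding sequent_weight_def using that expands_finite[OF expand(2)]
        by (intro member_le_sum) auto
      then show "concept_weight (fst B) < concept_weight (fst A)"
        using expands_weight_less[OF expand(2)] by simp
    qed (use that expand(1) in blast)
    with expand(2) show ?thesis by (blast intro: expands_sat_assertion)
  next
    case irreducible
    then show ?thesis
    proof (cases A rule: irreducible.cases)
      case (1 p b c)
      then show ?thesis
        using less.prems
          holds_unit_value[OF finite_atom_bounds[OF finite_H] unit_consistent_atom_bounds]
        by (simp add: atom_bounds_def)
    next
      case (6 R C b c)
      have "holds b (ceval model C y) (of_rat c)" if "y \<in> I" "(C, b, c) \<in> H y" for y
        using less.hyps[of "(C, b, c)" y] that 6 by simp
      then show ?thesis
        using ceval_ExR_upper ceval_ExR_lower less.prems unfolding 6 sat_assertion.simps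
        by (cases b rule: upper_lower_cases) blast+
    qed (auto simp: holds_lower_max simp del: holds.simps)
  qed
qed

lemma reindex:
  assumes "inj_on f I"
  shows "hintikka_family T (f ` I) (H \<circ> inv_into I f)"
  using assms nonempty tableau_sequent hintikka T_mem successor_exists
  by unfold_locales force+

end


section \<open>From consistent markings to families of Hintikka sets\<close>

lemma countable_rtrancl_Image:
  assumes "\<And>x. countable (r `` {x})"
  shows "countable (r\<^sup>* `` {x})"
proof -
  have "countable (r `` Y)" if "countable Y" for Y
    using that assms unfolding Image_eq_UN[of r Y] by (intro countable_UN) auto
  then show ?thesis by (intro countable_rtrancl) auto
qed

locale open_sequents =
  fixes T :: "('p, 'r) concept" and \<L> :: "('p, 'r) assertion set set"
  assumes tableau_sequent: "P \<in> \<L> \<Longrightarrow> tableau_sequent P"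
    and or_step: "P \<in> \<L> \<Longrightarrow> \<not> saturated (Seq P) \<Longrightarrow> \<exists>Q P'. prop_rule P Q \<and> Seq P' \<in> Q \<and> P' \<in> \<L>"
    and and_step: "P \<in> \<L> \<Longrightarrow> saturated (Seq P) \<Longrightarrow> ex_rule T P Q \<Longrightarrow> Q \<in> \<L>"
begin

definition hintikka_extension :: "('p, 'r) assertion set \<Rightarrow> ('p, 'r) assertion set \<Rightarrow> bool" where
  "hintikka_extension P H \<longleftrightarrow>
     P \<subseteq> H \<and> tableau_sequent H \<and> hintikka H \<and> (\<forall>Q. ex_rule T H Q \<longrightarrow> Q \<in> \<L>)"

lemma hintikka_extension_insert:
  assumes "hintikka_extension (S \<union> N) H" "expands A N" "tableau_sequent {A}"
  shows "hintikka_extension (insert A S) (insert A H)"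
proof -
  have "fst A \<noteq> ExR R C" for R C
    using assms(2) not_expands_ExR by (metis prod.collapse)
  then have "ex_rule T (insert A H) Q \<longleftrightarrow> ex_rule T H Q" for Q
    by (rule ex_rule_insert)
  then show ?thesis
    using assms hintikka_insert[OF _ assms(2)] tableau_sequent_Un[of "{A}" H]
    by (auto simp: hintikka_extension_def)
qed

lemma hintikka_extension_exists:
  assumes "P \<in> \<L>"
  shows "\<exists>H. hintikka_extension P H"
  using assms
proof (induction "sequent_weight P" arbitrary: P rule: less_induct)
  case less
  show ?case
  proof (cases "saturated (Seq P)")
    case True
    then have "hintikka_extension P P"
      using less.prems tableau_sequent and_step hintikka_saturated
      by (auto simp: hintikka_extension_def)
    then show ?thesis ..
  next
    case False
    then obtain Q P' where step: "prop_rule P Q" "Seq P' \<in> Q" "P' \<in> \<L>"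
      using or_step less.prems by blast
    then have "sequent_weight P' < sequent_weight P"
      using prop_rule_weight_less tableau_sequent_finite tableau_sequent less.prems by blast
    then obtain H where H: "hintikka_extension P' H" using less.hyps step(3) by blast
    obtain A S N where expansion: "expands A N" "P = insert A S" "P' = S \<union> N"
      using step(1,2) by (rule prop_rule_expandsE)
    then have "tableau_sequent {A}"
      using tableau_sequent[OF less.prems] by (auto intro: tableau_sequent_subset)
    then show ?thesis using hintikka_extension_insert H expansion by blast
  qed
qed

definition hintikka_closure :: "('p, 'r) assertion set \<Rightarrow> ('p, 'r) assertion set" where
  "hintikka_closure P = (SOME H. hintikka_extension P H)"

definition ex_step :: "(('p, 'r) assertion set \<times> ('p, 'r) assertion set) set" where
  "ex_step = {(P, Q). P \<in> \<L> \<and> ex_rule T (hintikka_closure P) Q}"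

lemma hintikka_extension_closure:
  "P \<in> \<L> \<Longrightarrow> hintikka_extension P (hintikka_closure P)"
  unfolding hintikka_closure_def by (rule someI_ex[OF hintikka_extension_exists])

lemma countable_ex_step_reachable: "countable (ex_step\<^sup>* `` {P})"
proof (rule countable_rtrancl_Image)
  fix P
  show "countable (ex_step `` {P})"
  proof (cases "P \<in> \<L>")
    case True
    then have "finite (hintikka_closure P)"
      using hintikka_extension_closure tableau_sequent_finite by (auto simp: hintikka_extension_def)
    then have "finite (ex_step `` {P})"
      using True finite_ex_rule[of "hintikka_closure P" T] by (simp add: ex_step_def Image_def)
    then show ?thesis by (rule countable_finite)
  qed (simp add: ex_step_def Image_def)
qed

lemma ex_step_mem:
  assumes "(P, Q) \<in> ex_step"
  shows "Q \<in> \<L>" "(T, Ge, 1) \<in> Q"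
  using assms hintikka_extension_closure[of P]
  by (auto simp: ex_step_def hintikka_extension_def ex_rule_iff ex_conclusion_def)

lemma hintikka_family_reachable:
  assumes "P\<^sub>0 \<in> \<L>" "(T, Ge, 1) \<in> P\<^sub>0"
  shows "hintikka_family T (ex_step\<^sup>* `` {P\<^sub>0}) hintikka_closure"
proof
  show "ex_step\<^sup>* `` {P\<^sub>0} \<noteq> {}" by blast
next
  fix P assume reachable: "P \<in> ex_step\<^sup>* `` {P\<^sub>0}"
  then have P: "P \<in> \<L>" "(T, Ge, 1) \<in> P"
    using assms ex_step_mem by (auto elim: rtranclE)
  then have closure: "hintikka_extension P (hintikka_closure P)"
    using hintikka_extension_closure by blast
  then show "tableau_sequent (hintikka_closure P)" "hintikka (hintikka_closure P)"
    "(T, Ge, 1) \<in> hintikka_closure P"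
    using P(2) by (auto simp: hintikka_extension_def)
  fix Q assume "ex_rule T (hintikka_closure P) Q"
  then have step: "(P, Q) \<in> ex_step" using P(1) by (simp add: ex_step_def)
  then have "Q \<in> ex_step\<^sup>* `` {P\<^sub>0}" using reachable by (auto intro: rtrancl_into_rtrancl)
  moreover have "Q \<subseteq> hintikka_closure Q"
    using hintikka_extension_closure[OF ex_step_mem(1)[OF step]]
    by (simp add: hintikka_extension_def)
  ultimately show "\<exists>Q' \<in> ex_step\<^sup>* `` {P\<^sub>0}. Q \<subseteq> hintikka_closure Q'" ..
qed

lemma countable_model_exists:
  assumes "P \<in> \<L>" "(T, Ge, 1) \<in> P"
  obtains I :: "(nat, 'p, 'r) interp" and x
  where "interpretation_ok I" "x \<in> indivs I" "\<forall>A \<in> P. sat_assertion I x A"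
    "\<forall>y \<in> indivs I. ceval I T y \<ge> 1"
proof -
  define W where "W = ex_step\<^sup>* `` {P}"
  obtain f :: "('p, 'r) assertion set \<Rightarrow> nat" where inj: "inj_on f W"
    using countable_ex_step_reachable unfolding countable_def W_def by blast
  interpret hintikka_family T "f ` W" "hintikka_closure \<circ> inv_into W f"
    using hintikka_family_reachable[OF assms] inj unfolding W_def
    by (rule hintikka_family.reindex)
  have P_mem: "P \<in> W" by (simp add: W_def)
  have "P \<subseteq> hintikka_closure (inv_into W f (f P))"
    using hintikka_extension_closure[OF assms(1)] inj P_mem by (simp add: hintikka_extension_def)
  then have "\<forall>A \<in> P. sat_assertion model (f P) A"
    using sat_assertion_model[of "f P"] P_mem by auto
  moreover have "\<forall>y \<in> indivs model. ceval model T y \<ge> 1"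
    using sat_assertion_model[OF _ T_mem] by simp
  moreover have "f P \<in> indivs model" using P_mem by simp
  ultimately show thesis using that interpretation_ok_model by blast
qed

end

lemma marking_or_step:
  assumes tableau: "tableau G \<Gamma> T" and marking: "consistent_marking G M"
    and "v \<in> M" "lab G v = Seq P" "\<not> saturated (Seq P)"
  shows "\<exists>Q P'. prop_rule P Q \<and> Seq P' \<in> Q \<and> (\<exists>w \<in> M. lab G w = Seq P')"
proof -
  have or_node: "or_node G v" using assms(4,5) by (simp add: and_node_def)
  have "v \<in> verts G" using assms(3) marking by (auto simp: consistent_marking_def marking_def)
  then obtain Q where Q: "prop_rule P Q" "lab G ` children G v = Q"
    using tableau or_node assms(4) unfolding tableau_def by fastforce
  obtain w where w: "w \<in> children G v" "w \<in> M"
    using marking or_node assms(3) unfolding consistent_marking_def marking_def by blast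
  then have "lab G w \<noteq> Bot" using marking by (simp add: consistent_marking_def)
  then obtain P' where "lab G w = Seq P'" by (cases "lab G w") auto
  then show ?thesis using Q w by force
qed

lemma marking_and_step:
  assumes tableau: "tableau G \<Gamma> T" and marking: "consistent_marking G M"
    and "v \<in> M" "lab G v = Seq P" "saturated (Seq P)" "ex_rule T P Q"
  shows "\<exists>w \<in> M. lab G w = Seq Q"
proof -
  have and_node: "and_node G v" using assms(4,5) by (simp add: and_node_def)
  have "v \<in> verts G" using assms(3) marking by (auto simp: consistent_marking_def marking_def)
  then have "lab G ` children G v = {Seq Q | P Q. lab G v = Seq P \<and> ex_rule T P Q}"
    using tableau and_node unfolding tableau_def by blast
  then have "Seq Q \<in> lab G ` children G v" using assms(4,6) by blast
  moreover have "children G v \<subseteq> M"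
    using marking and_node assms(3) unfolding consistent_marking_def marking_def by blast
  ultimately show ?thesis by force
qed

definition marked_sequents ::
    "('v, 'p, 'r) tableau_graph \<Rightarrow> 'v set \<Rightarrow> ('p, 'r) assertion set set" where
  "marked_sequents G M = {P. tableau_sequent P \<and> (\<exists>v \<in> M. lab G v = Seq P)}"

lemma open_sequents_marked_sequents:
  assumes "tableau G \<Gamma> T" "consistent_marking G M" "wf_concept T"
  shows "open_sequents T (marked_sequents G M)"
proof
  fix P assume "P \<in> marked_sequents G M"
  then obtain v where P: "tableau_sequent P" "v \<in> M" "lab G v = Seq P"
    by (auto simp: marked_sequents_def)
  show "tableau_sequent P" by (rule P(1))
  show "\<exists>Q P'. prop_rule P Q \<and> Seq P' \<in> Q \<and> P' \<in> marked_sequents G M" if "\<not> saturated (Seq P)"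
    using marking_or_step[OF assms(1,2) P(2,3) that] prop_rule_tableau_sequent[OF _ _ P(1)]
    unfolding marked_sequents_def by blast
  show "Q \<in> marked_sequents G M" if "saturated (Seq P)" "ex_rule T P Q" for Q
    using marking_and_step[OF assms(1,2) P(2,3) that]
      ex_rule_tableau_sequent[OF that(2) P(1) assms(3)]
    by (simp add: marked_sequents_def)
qed

lemma root_mem_marked_sequents:
  assumes "tableau G \<Gamma> T" "consistent_marking G M" "sequent \<Gamma>" "wf_concept T"
  shows "\<Gamma> \<union> {(T, Ge, 1)} \<in> marked_sequents G M"
proof -
  have "tableau_sequent (\<Gamma> \<union> {(T, Ge, 1)})"
    using assms(3,4) by (auto simp: tableau_sequent_def sequent_def)
  moreover have "root_node G \<in> M" "lab G (root_node G) = Seq (\<Gamma> \<union> {(T, Ge, 1)})"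
    using assms(1,2) by (auto simp: tableau_def consistent_marking_def marking_def)
  ultimately show ?thesis unfolding marked_sequents_def by blast
qed


section \<open>The associated concept assertion\<close>

lemma ceval_big_conj_ge_1:
  "ceval I (big_conj Cs) x \<ge> 1 \<Longrightarrow> C \<in> set Cs \<Longrightarrow> ceval I C x \<ge> 1"
  by (induction Cs rule: big_conj.induct) auto

lemma ceval_big_disj_ge_1:
  "ceval I (big_disj Cs) x \<ge> 1 \<Longrightarrow> \<exists>C \<in> set Cs. ceval I C x \<ge> 1"
  by (induction Cs rule: big_disj.induct) (auto simp: min_def split: if_splits)

(* The disjunct for z says exactly that C \<le> z \<le> D. *)
lemma ceval_gci_concept_ge_1:
  assumes "ceval I (gci_concept zs (C, D)) x \<ge> 1"
  shows "ceval I C x \<le> ceval I D x"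
proof -
  obtain z where "ceval I (Conj (Oplus (Neg C) z) (Oplus D (1 - z))) x \<ge> 1"
    using ceval_big_disj_ge_1[OF assms[unfolded gci_concept_def]] by auto
  then show ?thesis by (simp add: of_rat_diff)
qed

lemma assoc_concept_sat_tbox:
  assumes "assoc_concept TB \<Gamma> T" "\<forall>x \<in> indivs I. ceval I T x \<ge> 1"
  shows "sat_tbox I TB"
proof -
  obtain gs zs where TB: "set gs = TB" and T: "T = big_conj (map (gci_concept zs) gs)"
    using assms(1) by (auto simp: assoc_concept_def)
  have "ceval I C x \<le> ceval I D x" if "(C, D) \<in> TB" "x \<in> indivs I" for C D x
  proof (rule ceval_gci_concept_ge_1)
    have "gci_concept zs (C, D) \<in> set (map (gci_concept zs) gs)" using that(1) TB by auto
    then show "ceval I (gci_concept zs (C, D)) x \<ge> 1"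
      using assms(2) that(2) unfolding T by (blast intro: ceval_big_conj_ge_1)
  qed
  then show ?thesis by (auto simp: sat_tbox_def)
qed

lemma wf_big_conj: "(\<And>C. C \<in> set Cs \<Longrightarrow> wf_concept C) \<Longrightarrow> wf_concept (big_conj Cs)"
  by (induction Cs rule: big_conj.induct) auto

lemma wf_big_disj: "(\<And>C. C \<in> set Cs \<Longrightarrow> wf_concept C) \<Longrightarrow> wf_concept (big_disj Cs)"
  by (induction Cs rule: big_disj.induct) auto

lemma Zset'_subset_unit:
  assumes "sequent \<Gamma>" "tbox TB"
  shows "Zset' TB \<Gamma> \<subseteq> {0..1}"
proof -
  let ?Z = "Zset TB \<Gamma>"
  have one_mem: "1 \<in> group_closure (insert 1 (all_consts TB \<Gamma>))"
    by (intro group_closure.base) simp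
  have finite_Z: "finite (?Z - {0})" using finite_Zset[OF assms] by simp
  have "1 \<in> ?Z - {0}" using one_mem by (simp add: Zset_def)
  then have "Min (?Z - {0}) \<in> ?Z - {0}" using finite_Z by (intro Min_in) auto
  then have Min_nonneg: "0 \<le> Min (?Z - {0})" by (simp add: Zset_def)
  have "z + Zeps TB \<Gamma> \<in> {0..1}" if z: "z \<in> ?Z - {1}" for z
  proof -
    have "1 - z \<in> ?Z - {0}"
      using z one_mem by (auto simp: Zset_def intro: group_closure.diff)
    then have "Min (?Z - {0}) \<le> 1 - z" using finite_Z by (intro Min_le)
    moreover have "0 \<le> z" using z by (simp add: Zset_def)
    ultimately show ?thesis using Min_nonneg by (simp add: Zeps_def)
  qed
  moreover have "?Z \<subseteq> {0..1}" by (auto simp: Zset_def)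
  ultimately show ?thesis by (auto simp only: Zset'_def)
qed

lemma wf_assoc_concept:
  assumes "sequent \<Gamma>" "tbox TB" "assoc_concept TB \<Gamma> T"
  shows "wf_concept T"
proof -
  obtain gs zs where gs: "set gs = TB" and zs: "set zs = Zset' TB \<Gamma>"
    and T: "T = big_conj (map (gci_concept zs) gs)"
    using assms(3) by (auto simp: assoc_concept_def)
  have "wf_concept (gci_concept zs g)" if "g \<in> TB" for g
  proof -
    have "wf_concept (fst g)" "wf_concept (snd g)"
      using that assms(2) by (auto simp: tbox_def)
    moreover have "z \<in> {0..1}" if "z \<in> set zs" for z
      using that Zset'_subset_unit[OF assms(1,2)] zs by blast
    ultimately show ?thesis
      unfolding gci_concept_def by (intro wf_big_disj) auto
  qed
  then show ?thesis unfolding T by (intro wf_big_conj) (auto simp: gs)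
qed

theorem theorem1:
  fixes \<Gamma> :: "('p, 'r) assertion set"
    and TB :: "('p, 'r) gci set"
    and T :: "('p, 'r) concept"
  assumes "sequent \<Gamma>"
    and "tbox TB"
    and "assoc_concept TB \<Gamma> T"
    and "\<exists>G :: ('v, 'p, 'r) tableau_graph. tableau G \<Gamma> T \<and> open_tableau G"
  shows "satisfiable TYPE(nat) TB \<Gamma>"
proof -
  obtain G :: "('v, 'p, 'r) tableau_graph" and M
    where tableau: "tableau G \<Gamma> T" and marking: "consistent_marking G M"
    using assms(4) unfolding open_tableau_def by blast
  have wf: "wf_concept T" using assms(1-3) by (rule wf_assoc_concept)
  interpret open_sequents T "marked_sequents G M"
    using tableau marking wf by (rule open_sequents_marked_sequents)
  have root: "\<Gamma> \<union> {(T, Ge, 1)} \<in> marked_sequents G M"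
    using tableau marking assms(1) wf by (rule root_mem_marked_sequents)
  obtain I :: "(nat, 'p, 'r) interp" and x where model: "interpretation_ok I" "x \<in> indivs I"
    "\<forall>A \<in> \<Gamma> \<union> {(T, Ge, 1)}. sat_assertion I x A" "\<forall>y \<in> indivs I. ceval I T y \<ge> 1"
    using root by (rule countable_model_exists) simp
  have "sat_tbox I TB" using assms(3) model(4) by (rule assoc_concept_sat_tbox)
  then show ?thesis using model(1-3) unfolding satisfiable_def by blast
qed

end
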